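(* Let $(\mathscr{D},q)$ be a finite quadratic form. Then there exists a group automorphism $\gamma$ of $\mathscr{D}$ with $q\circ\gamma=-q$ (i.e. $(\mathscr{D},q)\cong(\mathscr{D},-q)$) if and only if the Gauss sums $\tau_n(q)=\sum_{x\in\mathscr{D}}e^{2\pi i n q(x)}$ are real numbers for all $n=1,2,3,\dots$.
   Context: A finite quadratic form $(\mathscr{D},q)$ is a finite abelian group $\mathscr{D}$ with a map $q:\mathscr{D}\to\mathbb{Q}/\mathbb{Z}$ such that $q(nx)=n^2q(x)$ for all $n\in\mathbb{Z}$, $x\in\mathscr{D}$, and $b(x,y)=q(x+y)-q(x)-q(y)$ is a non-degenerate symmetric bilinear form $\mathscr{D}\times\mathscr{D}\to\mathbb{Q}/\mathbb{Z}$. *)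

theory Defs
  imports Complex_Main
begin

text \<open>Finite abelian group: a type of class finite and ab_group_add.
  Values in Q/Z are represented by rationals, equalities in Q/Z being
  read as "difference is an integer".\<close>

definition intmul :: "int \<Rightarrow> 'a::ab_group_add \<Rightarrow> 'a" where
  "intmul n x = (if 0 \<le> n then (\<Sum>i<nat n. x) else - (\<Sum>i<nat (- n). x))"

definition bform :: "('a::ab_group_add \<Rightarrow> rat) \<Rightarrow> 'a \<Rightarrow> 'a \<Rightarrow> rat" where
  "bform q x y = q (x + y) - q x - q y"

definition finite_quadratic_form :: "('a::{finite,ab_group_add} \<Rightarrow> rat) \<Rightarrow> bool" where
  "finite_quadratic_form q \<longleftrightarrow>
     (\<forall>n x. q (intmul n x) - (of_int n)^2 * q x \<in> \<int>) \<and>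
     (\<forall>x y z. bform q (x + y) z - bform q x z - bform q y z \<in> \<int>) \<and>
     (\<forall>x y z. bform q x (y + z) - bform q x y - bform q x z \<in> \<int>) \<and>
     (\<forall>x. (\<forall>y. bform q x y \<in> \<int>) \<longrightarrow> x = 0)"

definition gauss_sum :: "nat \<Rightarrow> ('a::finite \<Rightarrow> rat) \<Rightarrow> complex" where
  "gauss_sum n q = (\<Sum>x\<in>UNIV. exp (2 * pi * \<i> * of_nat n * of_real (of_rat (q x))))"

end

theory Submission
  imports Defs "HOL-Library.FuncSet" "HOL-Library.Cardinality" "HOL-Number_Theory.Cong"
begin

text \<open>An anti-isometry turns every Gauss sum into its complex conjugate. For the converse, call a
  map \<open>f\<close> from the group to itself an isometry (anti-isometry) if it preserves (negates) the values
  of \<open>q\<close> and \<open>b\<close>; by nondegeneracy such a map is automatically bijective and additive. By Fourier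
  inversion, the numbers of isometries and of anti-isometries are complex conjugate, hence equal,
  provided that the Gauss sums of \<open>q \<otimes> c\<close> are real for all symmetric integer matrices \<open>c\<close>; as the
  identity is an isometry, an anti-isometry then exists.

  To prove that these Gauss sums are real, split the level of \<open>q\<close> into prime powers and diagonalise
  \<open>c\<close> modulo \<open>p ^ a\<close>. A one-dimensional block contributes some \<open>\<tau>\<^sub>n(q)\<close>, which is real by
  assumption. Blocks of size two are only needed when their diagonal vanishes modulo \<open>p\<close> and their
  off-diagonal entry does not; such a block is equivalent to its negative, so that its Gauss sum is
  real for every \<open>q\<close>.\<close>

section \<open>Rationals modulo integers and integer multiples\<close>

definition zcong :: "rat \<Rightarrow> rat \<Rightarrow> bool" (infix "\<simeq>" 50) where
  "r \<simeq> s \<longleftrightarrow> r - s \<in> \<int>"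

lemma zcong_refl [simp, intro]: "r \<simeq> r"
  by (simp add: zcong_def)

lemma zcong_sym: "r \<simeq> s \<Longrightarrow> s \<simeq> r"
  unfolding zcong_def by (metis Ints_minus minus_diff_eq)

lemma zcong_trans [trans]: "r \<simeq> s \<Longrightarrow> s \<simeq> t \<Longrightarrow> r \<simeq> t"
  unfolding zcong_def by (metis Ints_add add.commute diff_add_cancel add_diff_eq)

lemma zcong_add: "r \<simeq> s \<Longrightarrow> r' \<simeq> s' \<Longrightarrow> r + r' \<simeq> s + s'"
  unfolding zcong_def by (metis Ints_add add_diff_add)

lemma zcong_minus: "r \<simeq> s \<Longrightarrow> - r \<simeq> - s"
  unfolding zcong_def by (metis Ints_minus minus_diff_commute minus_diff_minus)

lemma zcong_diff: "r \<simeq> s \<Longrightarrow> r' \<simeq> s' \<Longrightarrow> r - r' \<simeq> s - s'"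
  using zcong_add[of r s "- r'" "- s'"] zcong_minus by simp

lemma zcong_mult: "r \<simeq> s \<Longrightarrow> of_int n * r \<simeq> of_int n * s"
  unfolding zcong_def by (metis Ints_mult Ints_of_int right_diff_distrib)

lemma zcong_sum: "(\<And>i. i \<in> I \<Longrightarrow> r i \<simeq> s i) \<Longrightarrow> sum r I \<simeq> sum s I"
  by (induction I rule: infinite_finite_induct) (auto intro!: zcong_add)

lemma zcong_0_iff: "r \<simeq> 0 \<longleftrightarrow> r \<in> \<int>"
  by (simp add: zcong_def)

section \<open>The additive character of Q/Z\<close>

definition ef :: "rat \<Rightarrow> complex" where
  "ef r = cis (2 * pi * of_rat r)"

lemma ef_add: "ef (r + s) = ef r * ef s"
  by (simp add: ef_def cis_mult of_rat_add algebra_simps)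

lemma ef_0 [simp]: "ef 0 = 1"
  by (simp add: ef_def)

lemma ef_minus: "ef (- r) = cnj (ef r)"
  by (simp add: ef_def cis_cnj of_rat_minus)

lemma ef_sum: "ef (sum r I) = (\<Prod>i\<in>I. ef (r i))"
  by (induction I rule: infinite_finite_induct) (auto simp: ef_add)

lemma ef_eq_1_iff: "ef r = 1 \<longleftrightarrow> r \<in> \<int>"
proof
  assume "ef r = 1"
  then have "cos (2 * pi * of_rat r) = 1"
    by (simp add: ef_def cis.code complex_eq_iff)
  then obtain k :: int where "2 * pi * of_rat r = of_int k * 2 * pi"
    by (auto simp: cos_one_2pi_int)
  then have "(of_rat r :: real) = of_rat (of_int k)"
    by simp
  then have "r = of_int k"
    by (simp only: of_rat_eq_iff)
  then show "r \<in> \<int>" by simp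
next
  assume "r \<in> \<int>"
  then obtain k where "r = of_int k" by (elim Ints_cases)
  then show "ef r = 1"
    by (simp add: ef_def cis_multiple_2pi)
qed

lemma ef_cong: "r \<simeq> s \<Longrightarrow> ef r = ef s"
  using ef_add[of "r - s" s] ef_eq_1_iff[of "r - s"] by (simp add: zcong_def)

section \<open>Integer multiples in an abelian group\<close>

lemma intmul_nat: "intmul (int n) x = (\<Sum>i<n. x)"
  by (simp add: intmul_def)

lemma intmul_0 [simp]: "intmul 0 x = 0"
  by (simp add: intmul_def)

lemma intmul_1 [simp]: "intmul 1 x = x"
  by (simp add: intmul_def)

lemma intmul_minus_left: "intmul (- n) x = - intmul n x"
  by (auto simp: intmul_def)

lemma intmul_succ: "intmul (n + 1) x = intmul n x + x"
proof (cases "0 \<le> n")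
  case True
  then show ?thesis by (simp add: intmul_def nat_add_distrib add.commute)
next
  case False
  then obtain k where k: "n = - int (Suc k)"
    by (metis nat_0_le not_le int_cases2 negative_zle_0 of_nat_0_le_iff old.nat.exhaust minus_zero of_nat_0)
  then have "n + 1 = - int k" by simp
  with k show ?thesis
    unfolding intmul_minus_left intmul_nat by (simp only: intmul_minus_left intmul_nat) simp
qed

lemma intmul_add_left: "intmul (m + n) x = intmul m x + intmul n x"
proof (induction n rule: int_induct[where k = 0])
  case (step1 i)
  then show ?case using intmul_succ[of "m + i" x] intmul_succ[of i x] by (simp add: ac_simps)
next
  case (step2 i)
  then show ?case using intmul_succ[of "m + i - 1" x] intmul_succ[of "i - 1" x]
    by (simp add: algebra_simps)
qed simp

lemma intmul_add_right: "intmul n (x + y) = intmul n x + intmul n y"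
  by (auto simp: intmul_def sum.distrib)

lemma intmul_zero_right [simp]: "intmul n 0 = 0"
  by (simp add: intmul_def)

lemma intmul_minus_right: "intmul n (- x) = - intmul n x"
  using intmul_add_right[of n x "- x"] by (simp add: eq_neg_iff_add_eq_0 add.commute)

lemma intmul_diff_right: "intmul n (x - y) = intmul n x - intmul n y"
  using intmul_add_right[of n x "- y"] by (simp add: intmul_minus_right)

lemma intmul_mult: "intmul (m * n) x = intmul m (intmul n x)"
proof (induction m rule: int_induct[where k = 0])
  case (step1 i)
  then show ?case by (simp add: distrib_right intmul_add_left)
next
  case (step2 i)
  then show ?case
    using intmul_succ[of "i - 1" "intmul n x"] intmul_add_left[of "(i - 1) * n" n x]
    by (simp add: algebra_simps)
qed simp

lemma intmul_sum: "intmul n (sum g I) = (\<Sum>i\<in>I. intmul n (g i))"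
  by (induction I rule: infinite_finite_induct) (auto simp: intmul_add_right)

text \<open>Translation by \<open>x\<close> permutes the group, so the sum of all elements absorbs
  \<open>CARD('a)\<close> copies of \<open>x\<close>.\<close>

lemma intmul_card: "intmul (int CARD('a)) x = (0 :: 'a::{finite,ab_group_add})"
proof -
  have "(\<Sum>y\<in>UNIV. y) = (\<Sum>y\<in>UNIV. y + x)"
    by (rule sum.reindex_bij_witness[of _ "\<lambda>y. y + x" "\<lambda>y. y - x"]) auto
  then have "(\<Sum>y\<in>(UNIV::'a set). x) = 0"
    by (simp add: sum.distrib)
  moreover have "(\<Sum>y\<in>A. x) = intmul (int (card A)) x" if "finite A" for A :: "'a set"
    using that by (induction A) (auto simp: intmul_add_left add.commute)
  ultimately show ?thesis by simp
qed

lemma intmul_eq_0_coprime: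
  fixes x :: "'a::{finite,ab_group_add}"
  assumes "coprime n (int CARD('a))" "intmul n x = 0"
  shows "x = 0"
proof -
  obtain u v where "u * n + v * int CARD('a) = 1"
    using assms(1) by (metis bezout_int coprime_imp_gcd_eq_1)
  then have "x = intmul (u * n + v * int CARD('a)) x" by simp
  also have "\<dots> = 0" by (simp only: intmul_add_left intmul_mult intmul_card assms(2)) simp
  finally show ?thesis .
qed

section \<open>Quadratic maps\<close>

text \<open>Nondegeneracy is dropped, so that quadratic maps are closed under multiplication by integers.\<close>

definition quad_map :: "('a::ab_group_add \<Rightarrow> rat) \<Rightarrow> bool" where
  "quad_map q \<longleftrightarrow>
     (\<forall>n x. q (intmul n x) \<simeq> of_int (n\<^sup>2) * q x) \<and>
     (\<forall>x y z. bform q (x + y) z \<simeq> bform q x z + bform q y z)"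

lemma bform_commute: "bform q x y = bform q y x"
  by (simp add: bform_def add.commute)

lemma q_add: "q (x + y) = q x + bform q x y + q y"
  by (simp add: bform_def)

lemma bform_scale: "bform (\<lambda>x. k * q x) x y = k * bform q x y"
  by (simp add: bform_def algebra_simps)

lemma bform_level:
  assumes "\<And>x. of_int M * q x \<in> \<int>"
  shows "of_int M * bform q x y \<in> \<int>"
  using assms by (simp add: bform_def right_diff_distrib)

lemma quad_map_scale:
  assumes "quad_map q"
  shows "quad_map (\<lambda>x. of_int k * q x)"
  unfolding quad_map_def bform_scale
proof (intro conjI allI)
  fix n x
  show "of_int k * q (intmul n x) \<simeq> of_int (n\<^sup>2) * (of_int k * q x)"
    using zcong_mult[of "q (intmul n x)" "of_int (n\<^sup>2) * q x" k] assms
    by (simp add: quad_map_def mult.left_commute)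
next
  fix x y z
  show "of_int k * bform q (x + y) z \<simeq> of_int k * bform q x z + of_int k * bform q y z"
    using zcong_mult[of "bform q (x + y) z" "bform q x z + bform q y z" k] assms
    by (simp add: quad_map_def distrib_left)
qed

context
  fixes q :: "'a::ab_group_add \<Rightarrow> rat"
  assumes quad: "quad_map q"
begin

lemma q_intmul: "q (intmul n x) \<simeq> of_int (n\<^sup>2) * q x"
  and bform_add_left: "bform q (x + y) z \<simeq> bform q x z + bform q y z"
  using quad by (auto simp: quad_map_def)

lemma bform_add_right: "bform q z (x + y) \<simeq> bform q z x + bform q z y"
  using bform_add_left by (simp add: bform_commute)

lemma q_0: "q 0 \<simeq> 0"
  using q_intmul[of 0 0] by simp

lemma bform_zero_left: "bform q 0 z \<simeq> 0"
  using zcong_minus[OF q_0] by (simp add: bform_def)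

lemma bform_minus_left: "bform q (- x) z \<simeq> - bform q x z"
proof -
  have "bform q (- x) z + bform q x z \<simeq> 0"
    using zcong_trans[OF zcong_sym[OF bform_add_left[of "- x" x z]]] bform_zero_left by simp
  then show ?thesis by (simp add: zcong_def)
qed

lemma bform_intmul_left: "bform q (intmul n x) z \<simeq> of_int n * bform q x z"
proof (induction n rule: int_induct[where k = 0])
  case base
  then show ?case by (simp add: bform_zero_left)
next
  case (step1 i)
  have "bform q (intmul (i + 1) x) z \<simeq> bform q (intmul i x) z + bform q x z"
    unfolding intmul_succ by (rule bform_add_left)
  also have "\<dots> \<simeq> of_int i * bform q x z + bform q x z"
    by (intro zcong_add step1 zcong_refl)
  finally show ?case by (simp add: algebra_simps)
next
  case (step2 i)
  have "bform q (intmul (i - 1) x) z \<simeq> bform q (intmul i x) z + bform q (- x) z"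
    using bform_add_left[of "intmul i x" "- x" z] intmul_succ[of "i - 1" x]
    by (simp add: algebra_simps)
  also have "\<dots> \<simeq> of_int i * bform q x z + - bform q x z"
    by (intro zcong_add step2 bform_minus_left)
  finally show ?case by (simp add: algebra_simps)
qed

lemma bform_intmul_right: "bform q z (intmul n x) \<simeq> of_int n * bform q z x"
  using bform_intmul_left by (simp add: bform_commute)

text \<open>The square law gives \<open>q (x + x) \<simeq> 4 * q x\<close>, and polarisation
  subtracts \<open>2 * q x\<close>.\<close>

lemma bform_self: "bform q x x \<simeq> 2 * q x"
proof -
  have "q (intmul 2 x) \<simeq> 4 * q x"
    using q_intmul[of 2 x] by simp
  moreover have "intmul 2 x = x + x"
    using intmul_succ[of 1 x] by simp
  ultimately show ?thesis by (simp add: bform_def zcong_def)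
qed

lemma bform_sum_right: "bform q z (sum g I) \<simeq> (\<Sum>i\<in>I. bform q z (g i))"
proof (induction I rule: infinite_finite_induct)
  case (insert i I)
  have "bform q z (g i + sum g I) \<simeq> bform q z (g i) + bform q z (sum g I)"
    by (rule bform_add_right)
  also have "\<dots> \<simeq> bform q z (g i) + (\<Sum>i\<in>I. bform q z (g i))"
    by (intro zcong_add insert zcong_refl)
  finally show ?case using insert by simp
qed (use bform_zero_left[of z] in \<open>simp_all add: bform_commute[of q z]\<close>)

lemma bform_lincomb_right:
  "bform q z (\<Sum>i\<in>I. intmul (c i) (g i)) \<simeq> (\<Sum>i\<in>I. of_int (c i) * bform q z (g i))"
  by (rule zcong_trans[OF bform_sum_right]) (intro zcong_sum bform_intmul_right)

lemma q_lincomb2: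
  "q (intmul a x + intmul b y) \<simeq>
     of_int (a\<^sup>2) * q x + of_int (a * b) * bform q x y + of_int (b\<^sup>2) * q y"
proof -
  have "bform q (intmul a x) (intmul b y) \<simeq> of_int a * bform q x (intmul b y)"
    by (rule bform_intmul_left)
  also have "\<dots> \<simeq> of_int a * (of_int b * bform q x y)"
    by (intro zcong_mult bform_intmul_right)
  finally have "bform q (intmul a x) (intmul b y) \<simeq> of_int (a * b) * bform q x y"
    by (simp add: mult.assoc)
  then show ?thesis
    unfolding q_add[of q] by (intro zcong_add q_intmul)
qed

lemma bform_lincomb2:
  "bform q (intmul a x + intmul b y) (intmul c x' + intmul d y') \<simeq>
     of_int (a * c) * bform q x x' + of_int (a * d) * bform q x y' +
     (of_int (b * c) * bform q y x' + of_int (b * d) * bform q y y')"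
proof -
  have 1: "bform q z (intmul c x' + intmul d y') \<simeq> of_int c * bform q z x' + of_int d * bform q z y'" for z
    by (rule zcong_trans[OF bform_add_right]) (intro zcong_add bform_intmul_right)
  have 2: "bform q (intmul a x) (intmul c x' + intmul d y') \<simeq>
      of_int a * (of_int c * bform q x x' + of_int d * bform q x y')" for a x
    by (rule zcong_trans[OF bform_intmul_left]) (intro zcong_mult 1)
  have "bform q (intmul a x + intmul b y) (intmul c x' + intmul d y') \<simeq>
      of_int a * (of_int c * bform q x x' + of_int d * bform q x y') +
      of_int b * (of_int c * bform q y x' + of_int d * bform q y y')"
    by (rule zcong_trans[OF bform_add_left]) (intro zcong_add 2)
  then show ?thesis by (simp add: algebra_simps)
qed

end

text \<open>The tensor product of \<open>q\<close> with the symmetric integer matrix \<open>c\<close>, evaluated at \<open>f\<close>;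
  only the entries of \<open>c\<close> on and below the diagonal are read.\<close>

definition qsum :: "('a::ab_group_add \<Rightarrow> rat) \<Rightarrow> nat set \<Rightarrow> (nat \<Rightarrow> nat \<Rightarrow> int) \<Rightarrow> (nat \<Rightarrow> 'a) \<Rightarrow> rat" where
  "qsum q I c f = (\<Sum>i\<in>I. of_int (c i i) * q (f i) +
     (\<Sum>j\<in>{j\<in>I. j < i}. of_int (c i j) * bform q (f i) (f j)))"

lemma qsum_scale: "qsum (\<lambda>x. k * q x) I c f = k * qsum q I c f"
  by (simp add: qsum_def bform_scale sum_distrib_left distrib_left mult.left_commute)

lemma qsum_scale_coeff: "qsum q I (\<lambda>i j. k * c i j) f = of_int k * qsum q I c f"
  by (simp add: qsum_def bform_scale sum_distrib_left distrib_left mult.assoc)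

lemma qsum_add_coeff: "qsum q I (\<lambda>i j. c i j + d i j) f = qsum q I c f + qsum q I d f"
  by (simp add: qsum_def distrib_right sum.distrib algebra_simps)

lemma qsum_cong:
  assumes "\<And>i j. i \<in> I \<Longrightarrow> j \<in> I \<Longrightarrow> c i j = d i j" "\<And>i. i \<in> I \<Longrightarrow> f i = g i"
  shows "qsum q I c f = qsum q I d g"
  unfolding qsum_def using assms by (intro sum.cong refl arg_cong2[of _ _ _ _ "(+)"]) auto

text \<open>The position of \<open>i\<close> relative to \<open>I\<close> is arbitrary: cross terms
  with \<open>j < i\<close> sit in row \<open>i\<close>, those with \<open>j > i\<close> in the rows
  \<open>j\<close>. Symmetry of \<open>c\<close> and of \<open>bform\<close> brings both into one
  sum.\<close>

lemma qsum_insert: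
  assumes "finite I" "i \<notin> I" "\<And>i j. c i j = c j i"
  shows "qsum q (insert i I) c f =
    of_int (c i i) * q (f i) + (\<Sum>j\<in>I. of_int (c i j) * bform q (f i) (f j)) + qsum q I c f"
proof -
  let ?t = "\<lambda>i j. of_int (c i j) * bform q (f i) (f j)"
  have 1: "{j \<in> insert i I. j < i} = {j \<in> I. j < i}" by auto
  have 2: "(\<Sum>k\<in>{k \<in> insert i I. k < j}. ?t j k) =
     (\<Sum>k\<in>{k \<in> I. k < j}. ?t j k) + (if i < j then ?t i j else 0)" if "j \<in> I" for j
  proof (cases "i < j")
    case True
    then have "{k \<in> insert i I. k < j} = insert i {k \<in> I. k < j}" by auto
    then show ?thesis using True assms by (simp add: bform_commute add.commute)
  next
    case False
    then have "{k \<in> insert i I. k < j} = {k \<in> I. k < j}" by auto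
    then show ?thesis using False by simp
  qed
  have 3: "(\<Sum>j\<in>I. if i < j then ?t i j else 0) = (\<Sum>j\<in>{j\<in>I. i < j}. ?t i j)"
    by (simp add: sum.inter_filter[OF assms(1)])
  have "I = {j\<in>I. j < i} \<union> {j\<in>I. i < j}"
    using assms(2) nat_neq_iff by blast
  then have "(\<Sum>j\<in>I. ?t i j) = (\<Sum>j\<in>{j\<in>I. j < i} \<union> {j\<in>I. i < j}. ?t i j)"
    by (rule arg_cong)
  also have "\<dots> = (\<Sum>j\<in>{j\<in>I. j < i}. ?t i j) + (\<Sum>j\<in>{j\<in>I. i < j}. ?t i j)"
    using assms by (intro sum.union_disjoint) auto
  finally have 4: "(\<Sum>j\<in>I. ?t i j) = \<dots>" .
  have 5: "(\<Sum>j\<in>I. \<Sum>k\<in>{k \<in> insert i I. k < j}. ?t j k) =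
      (\<Sum>j\<in>I. \<Sum>k\<in>{k \<in> I. k < j}. ?t j k) + (\<Sum>j\<in>{j\<in>I. i < j}. ?t i j)"
    unfolding 3[symmetric] sum.distrib[symmetric] by (intro sum.cong refl 2)
  show ?thesis
    unfolding qsum_def sum.insert[OF assms(1,2)] 1 4 sum.distrib 5 by simp
qed

text \<open>Evaluating \<open>q\<close> at a linear combination amounts to tensoring with a matrix
  of rank one, so completing a square only changes the coefficient matrix.\<close>

lemma q_lincomb:
  assumes "quad_map q" "finite I"
  shows "q (\<Sum>i\<in>I. intmul (a i) (f i)) \<simeq> qsum q I (\<lambda>i j. a i * a j) f"
  using assms(2)
proof (induction I)
  case empty
  then show ?case using q_0[OF assms(1)] by (simp add: qsum_def)
next
  case (insert i I)
  have "bform q (intmul (a i) (f i)) (\<Sum>i\<in>I. intmul (a i) (f i)) \<simeq>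
     of_int (a i) * bform q (f i) (\<Sum>i\<in>I. intmul (a i) (f i))"
    by (rule bform_intmul_left[OF assms(1)])
  also have "\<dots> \<simeq> of_int (a i) * (\<Sum>j\<in>I. of_int (a j) * bform q (f i) (f j))"
    by (intro zcong_mult bform_lincomb_right assms(1))
  also have "\<dots> = (\<Sum>j\<in>I. of_int (a i * a j) * bform q (f i) (f j))"
    by (simp add: sum_distrib_left mult.assoc)
  finally have *: "bform q (intmul (a i) (f i)) (\<Sum>i\<in>I. intmul (a i) (f i)) \<simeq> \<dots>" .
  have "q (\<Sum>i\<in>insert i I. intmul (a i) (f i)) \<simeq>
     of_int ((a i)\<^sup>2) * q (f i) + (\<Sum>j\<in>I. of_int (a i * a j) * bform q (f i) (f j)) +
     qsum q I (\<lambda>i j. a i * a j) f"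
    unfolding sum.insert[OF insert.hyps] q_add[of q]
    by (intro zcong_add q_intmul assms(1) * insert.IH)
  also have "\<dots> = qsum q (insert i I) (\<lambda>i j. a i * a j) f"
    by (subst qsum_insert[OF insert.hyps]) (auto simp: power2_eq_square)
  finally show ?case .
qed

text \<open>Polarisation of \<open>q_lincomb\<close>.\<close>

lemma bform_lincomb:
  assumes "quad_map q" "finite I"
  shows "bform q (\<Sum>i\<in>I. intmul (a i) (f i)) (\<Sum>i\<in>I. intmul (b i) (f i)) \<simeq>
    qsum q I (\<lambda>i j. a i * b j + b i * a j) f"
proof -
  have "(\<Sum>i\<in>I. intmul (a i) (f i)) + (\<Sum>i\<in>I. intmul (b i) (f i)) = (\<Sum>i\<in>I. intmul (a i + b i) (f i))"
    by (simp add: sum.distrib intmul_add_left)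
  then have "bform q (\<Sum>i\<in>I. intmul (a i) (f i)) (\<Sum>i\<in>I. intmul (b i) (f i)) =
    q (\<Sum>i\<in>I. intmul (a i + b i) (f i)) - q (\<Sum>i\<in>I. intmul (a i) (f i)) - q (\<Sum>i\<in>I. intmul (b i) (f i))"
    by (simp add: bform_def)
  also have "\<dots> \<simeq> qsum q I (\<lambda>i j. (a i + b i) * (a j + b j)) f - qsum q I (\<lambda>i j. a i * a j) f
      - qsum q I (\<lambda>i j. b i * b j) f"
    by (intro zcong_diff q_lincomb assms)
  also have "(\<lambda>i j. (a i + b i) * (a j + b j)) =
     (\<lambda>i j. (a i * b j + b i * a j) + (a i * a j + b i * b j))"
    by (simp add: fun_eq_iff algebra_simps)
  finally show ?thesis by (simp add: qsum_add_coeff)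
qed

section \<open>Splitting off blocks from a Gauss sum\<close>

text \<open>Coefficients matter only modulo the level \<open>M\<close>, so an inverse modulo
  \<open>M\<close> may serve as a true inverse.\<close>

lemma level_cong:
  assumes "of_int M * r \<in> \<int>" "M dvd a - b"
  shows "of_int a * r \<simeq> of_int b * (r :: rat)"
proof -
  obtain k where k: "a - b = M * k" using assms(2) by (elim dvdE)
  have "of_int a * r - of_int b * r = of_int (a - b) * r"
    by (simp add: left_diff_distrib)
  also have "\<dots> = of_int k * (of_int M * r)"
    unfolding k by simp
  also have "\<dots> \<in> \<int>" by (rule Ints_mult[OF Ints_of_int assms(1)])
  finally show ?thesis by (simp add: zcong_def)
qed

lemma sum_shift: "(\<Sum>x\<in>UNIV. F (x + a)) = (\<Sum>x\<in>UNIV. F (x :: 'a::{finite,ab_group_add}))"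
  by (rule sum.reindex_bij_witness[of _ "\<lambda>y. y - a" "\<lambda>y. y + a"]) auto

lemma sum_PiE_insert:
  assumes "i \<notin> I"
  shows "(\<Sum>f\<in>PiE (insert i I) (\<lambda>_. A). F f) = (\<Sum>f\<in>PiE I (\<lambda>_. A). \<Sum>x\<in>A. F (f(i := x)))"
proof -
  have "(\<Sum>f\<in>PiE (insert i I) (\<lambda>_. A). F f) = (\<Sum>(x, f)\<in>A \<times> PiE I (\<lambda>_. A). F (f(i := x)))"
    unfolding PiE_insert_eq
    by (subst sum.reindex) (use inj_combinator[OF assms, of "\<lambda>_. A"] in \<open>auto simp: case_prod_unfold\<close>)
  also have "\<dots> = (\<Sum>x\<in>A. \<Sum>f\<in>PiE I (\<lambda>_. A). F (f(i := x)))"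
    by (simp add: sum.cartesian_product)
  finally show ?thesis by (simp add: sum.swap[of _ A])
qed

text \<open>The multiplier is an integer because pivots of integer matrices may be negative.\<close>

definition tau :: "('a::finite \<Rightarrow> rat) \<Rightarrow> int \<Rightarrow> complex" where
  "tau q n = (\<Sum>x\<in>UNIV. ef (of_int n * q x))"

definition gsum :: "('a::{finite,ab_group_add} \<Rightarrow> rat) \<Rightarrow> nat set \<Rightarrow> (nat \<Rightarrow> nat \<Rightarrow> int) \<Rightarrow> complex" where
  "gsum q I c = (\<Sum>f\<in>PiE I (\<lambda>_. UNIV). ef (qsum q I c f))"

text \<open>The Gauss sum of \<open>q\<close> tensored with the symmetric 2 x 2 matrix that has
  diagonal \<open>n\<close>, \<open>n'\<close> and off-diagonal entry \<open>m\<close>.\<close>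

definition bsum :: "('a::{finite,ab_group_add} \<Rightarrow> rat) \<Rightarrow> int \<Rightarrow> int \<Rightarrow> int \<Rightarrow> complex" where
  "bsum q n m n' = (\<Sum>x\<in>UNIV. \<Sum>y\<in>UNIV. ef (of_int n * q x + of_int m * bform q x y + of_int n' * q y))"

lemma qsum_insert_upd:
  assumes "quad_map q" "finite I" "i \<notin> I" "\<And>i j. c i j = c j i"
  shows "qsum q (insert i I) c (f(i := x)) \<simeq>
    of_int (c i i) * q x + bform q x (\<Sum>j\<in>I. intmul (c i j) (f j)) + qsum q I c f"
proof -
  have "qsum q (insert i I) c (f(i := x)) =
      of_int (c i i) * q x + (\<Sum>j\<in>I. of_int (c i j) * bform q x (f j)) + qsum q I c f"
    unfolding qsum_insert[OF assms(2-4)] using assms(3)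
    by (intro arg_cong2[of _ _ _ _ "(+)"] sum.cong qsum_cong) auto
  also have "\<dots> \<simeq> of_int (c i i) * q x + bform q x (\<Sum>j\<in>I. intmul (c i j) (f j)) + qsum q I c f"
    by (intro zcong_add zcong_refl zcong_sym[OF bform_lincomb_right] assms)
  finally show ?thesis .
qed

text \<open>Completing the square in the variable \<open>i\<close>: with \<open>u\<close> inverse to
  the pivot, \<open>x\<close> is shifted by \<open>u\<close> times the linear form in row
  \<open>i\<close>, which leaves the sum over \<open>x\<close> unchanged. The remaining matrix is
  the Schur complement of the pivot modulo \<open>M\<close>.\<close>

lemma gsum_diag_pivot:
  fixes q :: "'a::{finite,ab_group_add} \<Rightarrow> rat"
  assumes q: "quad_map q" and M: "\<And>x. of_int M * q x \<in> \<int>"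
    and I: "finite I" "i \<notin> I" and c: "\<And>i j. c i j = c j i"
    and u: "M dvd c i i * u - 1"
  shows "gsum q (insert i I) c =
    tau q (c i i) * gsum q I (\<lambda>j k. c j k - c i i * ((u * c i j) * (u * c i k)))"
proof -
  let ?n = "c i i" and ?c' = "\<lambda>j k. c j k - c i i * ((u * c i j) * (u * c i k))"
  have *: "ef (qsum q (insert i I) c (f(i := x))) =
     ef (of_int ?n * q (x + (\<Sum>j\<in>I. intmul (u * c i j) (f j)))) * ef (qsum q I ?c' f)" for f x
  proof -
    let ?w = "\<Sum>j\<in>I. intmul (c i j) (f j)"
    let ?v = "\<Sum>j\<in>I. intmul (u * c i j) (f j)"
    have v: "?v = intmul u ?w" by (simp add: intmul_sum intmul_mult)
    have "of_int ?n * bform q x ?v \<simeq> of_int ?n * (of_int u * bform q x ?w)"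
      unfolding v by (intro zcong_mult bform_intmul_right q)
    also have "\<dots> = of_int (?n * u) * bform q x ?w" by simp
    also have "\<dots> \<simeq> of_int 1 * bform q x ?w"
      by (intro level_cong[OF _ u] bform_level[OF M])
    finally have 1: "bform q x ?w \<simeq> of_int ?n * bform q x ?v"
      by - (rule zcong_sym, simp)
    have 2: "of_int ?n * q ?v \<simeq> of_int ?n * qsum q I (\<lambda>j k. (u * c i j) * (u * c i k)) f"
      by (intro zcong_mult q_lincomb q I)
    have 3: "qsum q I c f = qsum q I ?c' f + of_int ?n * qsum q I (\<lambda>j k. (u * c i j) * (u * c i k)) f"
      unfolding qsum_scale_coeff[symmetric] qsum_add_coeff[symmetric] by simp
    have "qsum q (insert i I) c (f(i := x)) \<simeq> of_int ?n * q x + bform q x ?w + qsum q I c f"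
      by (rule qsum_insert_upd[OF q I c])
    also have "\<dots> \<simeq> of_int ?n * q x + of_int ?n * bform q x ?v +
        (qsum q I ?c' f + of_int ?n * q ?v)"
      unfolding 3 by (intro zcong_add zcong_refl 1 zcong_sym[OF 2])
    also have "\<dots> = of_int ?n * q (x + ?v) + qsum q I ?c' f"
      by (simp add: q_add[of q] algebra_simps)
    finally show ?thesis unfolding ef_add[symmetric] by (rule ef_cong)
  qed
  show ?thesis
    unfolding gsum_def tau_def sum_PiE_insert[OF I(2)] *
    sum_distrib_right[symmetric] sum_shift[of "\<lambda>x. ef (_ * q x)"] sum_distrib_left[symmetric] ..
qed

text \<open>Completing the square in two variables: \<open>a\<close> and \<open>b\<close> are the coefficients of the critical point
  of the exponent, viewed as a function of the variables \<open>i\<close> and \<open>j\<close>.\<close>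

lemma gsum_block_pivot:
  fixes q :: "'a::{finite,ab_group_add} \<Rightarrow> rat"
  assumes q: "quad_map q" and M: "\<And>x. of_int M * q x \<in> \<int>"
    and I: "finite I" "i \<notin> I" "j \<notin> I" "i \<noteq> j" and c: "\<And>i j. c i j = c j i"
    and d: "M dvd d * (c i i * c j j - (c i j)\<^sup>2) - 1"
    and a: "a = (\<lambda>k. d * (c i j * c j k - c j j * c i k))"
    and b: "b = (\<lambda>k. d * (c i j * c i k - c i i * c j k))"
  shows "gsum q (insert i (insert j I)) c =
    bsum q (c i i) (c i j) (c j j) *
    gsum q I (\<lambda>k l. c k l - (c i i * (a k * a l) + c i j * (a k * b l + b k * a l) + c j j * (b k * b l)))"
proof -
  let ?n = "c i i" and ?m = "c i j" and ?n' = "c j j"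
  let ?e = "\<lambda>k l. ?n * (a k * a l) + ?m * (a k * b l + b k * a l) + ?n' * (b k * b l)"
  let ?E = "\<lambda>x y. of_int ?n * q x + of_int ?m * bform q x y + of_int ?n' * q y"
  have *: "ef (qsum q (insert i (insert j I)) c (f(j := y, i := x))) =
     ef (?E (x - (\<Sum>k\<in>I. intmul (a k) (f k))) (y - (\<Sum>k\<in>I. intmul (b k) (f k)))) *
     ef (qsum q I (\<lambda>k l. c k l - ?e k l) f)" for f x y
  proof -
    let ?w = "\<Sum>k\<in>I. intmul (c i k) (f k)" and ?w' = "\<Sum>k\<in>I. intmul (c j k) (f k)"
    define A B where "A = (\<Sum>k\<in>I. intmul (a k) (f k))" and "B = (\<Sum>k\<in>I. intmul (b k) (f k))"
    define X Y where "X = x - A" and "Y = y - B"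
    note bl = bform_add_right[OF q] bform_intmul_right[OF q]
    have "qsum q I ?e f = of_int ?n * qsum q I (\<lambda>k l. a k * a l) f +
        of_int ?m * qsum q I (\<lambda>k l. a k * b l + b k * a l) f +
        of_int ?n' * qsum q I (\<lambda>k l. b k * b l) f"
      by (simp only: qsum_add_coeff qsum_scale_coeff)
    also have "\<dots> \<simeq> ?E A B"
      unfolding A_def B_def
      by (intro zcong_add zcong_mult zcong_sym[OF q_lincomb] zcong_sym[OF bform_lincomb] q I)
    finally have AB: "qsum q I ?e f \<simeq> ?E A B" .
    \<comment> \<open>\<open>A\<close> and \<open>B\<close> come from Cramer's rule, with
      \<open>d\<close> as inverse determinant. \<open>lin1\<close> and \<open>lin2\<close> verify
      that, paired with any \<open>z\<close>, they solve \<open>n A + m B = - w\<close> and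
      \<open>m A + n' B = - w'\<close>.\<close>
    have A: "A = intmul (d * ?m) ?w' + intmul (- d * ?n') ?w"
      unfolding A_def a intmul_sum
      by (simp add: sum.distrib[symmetric] intmul_mult[symmetric] intmul_add_left[symmetric] algebra_simps)
    have B: "B = intmul (d * ?m) ?w + intmul (- d * ?n) ?w'"
      unfolding B_def b intmul_sum
      by (simp add: sum.distrib[symmetric] intmul_mult[symmetric] intmul_add_left[symmetric] algebra_simps)
    have zA: "bform q z A \<simeq> of_int (d * ?m) * bform q z ?w' + of_int (- d * ?n') * bform q z ?w" for z
      unfolding A by (rule zcong_trans[OF bl(1)]) (intro zcong_add bl)
    have zB: "bform q z B \<simeq> of_int (d * ?m) * bform q z ?w + of_int (- d * ?n) * bform q z ?w'" for z
      unfolding B by (rule zcong_trans[OF bl(1)]) (intro zcong_add bl)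
    have lin1: "bform q z ?w \<simeq> - of_int ?n * bform q z A - of_int ?m * bform q z B" for z
    proof -
      have "of_int (- ?n) * bform q z A - of_int ?m * bform q z B \<simeq>
        of_int (- ?n) * (of_int (d * ?m) * bform q z ?w' + of_int (- d * ?n') * bform q z ?w) -
        of_int ?m * (of_int (d * ?m) * bform q z ?w + of_int (- d * ?n) * bform q z ?w')"
        by (intro zcong_diff zcong_mult zA zB)
      also have "\<dots> = of_int (d * (?n * ?n' - ?m\<^sup>2)) * bform q z ?w"
        by (simp add: algebra_simps power2_eq_square)
      also have "\<dots> \<simeq> of_int 1 * bform q z ?w"
        by (intro level_cong[OF _ d] bform_level[OF M])
      finally show ?thesis by - (rule zcong_sym, simp)
    qed
    have lin2: "bform q z ?w' \<simeq> - of_int ?m * bform q z A - of_int ?n' * bform q z B" for z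
    proof -
      have "of_int (- ?m) * bform q z A - of_int ?n' * bform q z B \<simeq>
        of_int (- ?m) * (of_int (d * ?m) * bform q z ?w' + of_int (- d * ?n') * bform q z ?w) -
        of_int ?n' * (of_int (d * ?m) * bform q z ?w + of_int (- d * ?n) * bform q z ?w')"
        by (intro zcong_diff zcong_mult zA zB)
      also have "\<dots> = of_int (d * (?n * ?n' - ?m\<^sup>2)) * bform q z ?w'"
        by (simp add: algebra_simps power2_eq_square)
      also have "\<dots> \<simeq> of_int 1 * bform q z ?w'"
        by (intro level_cong[OF _ d] bform_level[OF M])
      finally show ?thesis by - (rule zcong_sym, simp)
    qed
    have x: "x = X + A" and y: "y = Y + B" by (simp_all add: X_def Y_def)
    have wx: "(\<Sum>k\<in>insert j I. intmul (c i k) ((f(j := y)) k)) = intmul ?m y + ?w"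
      using I by (auto intro!: sum.cong)
    have "qsum q (insert i (insert j I)) c (f(j := y, i := x)) \<simeq>
       of_int ?n * q x + bform q x (intmul ?m y + ?w) + qsum q (insert j I) c (f(j := y))"
      unfolding wx[symmetric] using I by (intro qsum_insert_upd q c) auto
    also have "\<dots> \<simeq> of_int ?n * q x + (of_int ?m * bform q x y + bform q x ?w)
        + (of_int ?n' * q y + bform q y ?w' + qsum q I c f)"
      by (intro zcong_add zcong_refl zcong_trans[OF bl(1)] bl(2) qsum_insert_upd q I c)
    also have "\<dots> \<simeq> of_int ?n * q x + (of_int ?m * bform q x y +
        (- of_int ?n * bform q x A - of_int ?m * bform q x B)) +
        (of_int ?n' * q y + (- of_int ?m * bform q y A - of_int ?n' * bform q y B) + qsum q I c f)"
      by (intro zcong_add zcong_refl lin1 lin2)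
    also have "\<dots> = ?E x y - of_int ?n * bform q A x - of_int ?m * bform q x B
        - of_int ?m * bform q A y - of_int ?n' * bform q y B + qsum q I c f"
      by (simp add: bform_commute[of q _ A])
    \<comment> \<open>At the critical point the terms linear in \<open>X\<close> and
      \<open>Y\<close> cancel, and the constant left over is \<open>- ?E A B\<close>.\<close>
    also have "\<dots> \<simeq> ?E X Y - ?E A B + qsum q I c f"
    proof -
      have 1: "bform q x B \<simeq> bform q X B + bform q A B"
        unfolding x by (rule bform_add_left[OF q])
      have 2: "bform q A y \<simeq> bform q A Y + bform q A B"
        unfolding y by (rule bform_add_right[OF q])
      have 3: "bform q A x \<simeq> bform q A X + 2 * q A"
        unfolding x by (rule zcong_trans[OF bform_add_right[OF q]]) (intro zcong_add zcong_refl bform_self q)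
      have 4: "bform q y B \<simeq> bform q Y B + 2 * q B"
        unfolding y by (rule zcong_trans[OF bform_add_left[OF q]]) (intro zcong_add zcong_refl bform_self q)
      have 5: "bform q x y \<simeq> bform q X Y + bform q X B + (bform q A Y + bform q A B)"
        unfolding x y by (rule zcong_trans[OF bform_add_left[OF q]]) (intro zcong_add bform_add_right q)
      have 6: "q x = q X + bform q A X + q A" "q y = q Y + bform q Y B + q B"
        unfolding x y q_add[of q] by (simp_all add: bform_commute)
      have "?E x y - of_int ?n * bform q A x - of_int ?m * bform q x B
          - of_int ?m * bform q A y - of_int ?n' * bform q y B + qsum q I c f \<simeq>
        (of_int ?n * (q X + bform q A X + q A) +
         of_int ?m * (bform q X Y + bform q X B + (bform q A Y + bform q A B)) +
         of_int ?n' * (q Y + bform q Y B + q B))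
         - of_int ?n * (bform q A X + 2 * q A) - of_int ?m * (bform q X B + bform q A B)
         - of_int ?m * (bform q A Y + bform q A B) - of_int ?n' * (bform q Y B + 2 * q B) + qsum q I c f"
        unfolding 6 by (intro zcong_add zcong_diff zcong_mult zcong_refl 1 2 3 4 5)
      also have "\<dots> = ?E X Y - ?E A B + qsum q I c f"
        by (simp add: algebra_simps)
      finally show ?thesis .
    qed
    also have "\<dots> \<simeq> ?E X Y - qsum q I ?e f + qsum q I c f"
      by (intro zcong_add zcong_diff zcong_refl zcong_sym[OF AB])
    also have "\<dots> = ?E X Y + qsum q I (\<lambda>k l. c k l - ?e k l) f"
      using qsum_add_coeff[of q I "\<lambda>k l. c k l - ?e k l" ?e f] by simp
    finally show ?thesis unfolding X_def Y_def A_def B_def ef_add[symmetric] by (rule ef_cong)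
  qed
  have shift: "(\<Sum>x\<in>UNIV. \<Sum>y\<in>UNIV. ef (?E (x - A) (y - B))) = bsum q ?n ?m ?n'" for A B
    unfolding bsum_def
    using sum_shift[of "\<lambda>x. \<Sum>y\<in>UNIV. ef (?E x (y - B))" "- A"] sum_shift[of "\<lambda>y. ef (?E _ y)" "- B"]
    by simp
  have "gsum q (insert i (insert j I)) c = (\<Sum>f\<in>PiE I (\<lambda>_. UNIV). \<Sum>y\<in>UNIV. \<Sum>x\<in>UNIV.
      ef (qsum q (insert i (insert j I)) c (f(j := y, i := x))))"
    unfolding gsum_def using I by (subst sum_PiE_insert) (simp, subst sum_PiE_insert, simp_all)
  also have "\<dots> = (\<Sum>f\<in>PiE I (\<lambda>_. UNIV). bsum q ?n ?m ?n' * ef (qsum q I (\<lambda>k l. c k l - ?e k l) f))"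
    unfolding * by (subst sum.swap) (simp add: sum_distrib_right[symmetric] shift)
  finally show ?thesis by (simp add: gsum_def sum_distrib_left)
qed

section \<open>Reality of the matrix Gauss sums\<close>

text \<open>Modulo \<open>p\<close> the polynomial is linear with unit slope \<open>m\<close>, so
  Newton iteration can start at the trivial modulus \<open>p ^ 0\<close>.\<close>

lemma hensel:
  fixes A m :: int
  assumes p: "prime p" and A: "p dvd A" and m: "\<not> p dvd m"
  shows "\<exists>t. p ^ a dvd A * t\<^sup>2 + m * t + 1"
proof (induction a)
  case 0
  then show ?case by simp
next
  case (Suc a)
  then obtain t r where t: "A * t\<^sup>2 + m * t + 1 = p ^ a * r" by (metis dvdE)
  have "coprime m p"
    using prime_imp_coprime[OF p m] by (simp add: coprime_commute)
  then obtain v where "[m * v = 1] (mod p)"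
    using cong_solve_coprime_int by blast
  then obtain k where k: "m * v = 1 + p * k"
    by (metis cong_iff_lin cong_sym)
  obtain A' where A': "A = p * A'" using A by (elim dvdE)
  \<comment> \<open>The Newton correction: \<open>v\<close> inverts the derivative, which is
    \<open>m\<close> modulo \<open>p\<close>.\<close>
  define s where "s = t - p ^ a * (r * v)"
  have "A * s\<^sup>2 + m * s + 1 = (A * t\<^sup>2 + m * t + 1) + A * p ^ a * (p ^ a * (r * v)\<^sup>2 - 2 * t * (r * v))
      - p ^ a * r * (m * v)"
    unfolding s_def by (simp add: power2_eq_square algebra_simps)
  also have "\<dots> = p ^ Suc a * (A' * (p ^ a * (r * v)\<^sup>2 - 2 * t * (r * v)) - r * k)"
    unfolding t k unfolding A' by (simp add: algebra_simps)
  finally show ?case by (metis dvd_triv_left)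
qed

text \<open>The binary form \<open>n X\<^sup>2 + 2 m X Y + n' Y\<^sup>2\<close> is a multiple of the norm form of the order generated by
  \<open>\<omega>\<close> with \<open>\<omega>\<^sup>2 = 2 m \<omega> - n n'\<close>. The substitution below is multiplication by \<open>1 + t \<omega>\<close>, an element of
  norm \<open>N\<close>, so it multiplies the form by \<open>N\<close>, which is \<open>-1\<close> modulo the level.\<close>

lemma bsum_eq_cnj:
  fixes q :: "'a::{finite,ab_group_add} \<Rightarrow> rat"
  assumes q: "quad_map q" and M: "\<And>x. of_int M * q x \<in> \<int>"
    and N: "N = 1 + 2 * m * t + n * n' * t\<^sup>2" "M dvd N + 1" "coprime N (int CARD('a))"
  shows "bsum q n m n' = cnj (bsum q n m n')"
proof -
  let ?E = "\<lambda>x y. of_int n * q x + of_int m * bform q x y + of_int n' * q y"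
  let ?g = "\<lambda>(x :: 'a, y :: 'a). (intmul 1 x + intmul (- t * n') y, intmul (t * n) x + intmul (1 + 2 * m * t) y)"
  \<comment> \<open>\<open>?h\<close> is the adjugate of \<open>?g\<close>, that is, multiplication
    by the conjugate. Their composition is multiplication by \<open>N\<close>, injective because
    \<open>N\<close> is prime to the group order.\<close>
  let ?h = "\<lambda>(x :: 'a, y :: 'a). (intmul (1 + 2 * m * t) x + intmul (t * n') y, intmul (- t * n) x + intmul 1 y)"
  have hg: "?h (?g z) = (intmul N (fst z), intmul N (snd z))" for z
  proof (cases z)
    case (Pair x y)
    have *: "intmul a (intmul b x + intmul c y) + intmul a' (intmul b' x + intmul c' y) =
      intmul (a * b + a' * b') x + intmul (a * c + a' * c') y" for a b c a' b' c'
      by (simp add: intmul_add_right intmul_mult intmul_add_left ac_simps)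
    have c1: "(1 + 2 * m * t) * 1 + t * n' * (t * n) = N" "- t * n * (- t * n') + 1 * (1 + 2 * m * t) = N"
      "(1 + 2 * m * t) * (- t * n') + t * n' * (1 + 2 * m * t) = 0" "- t * n * 1 + 1 * (t * n) = 0"
      unfolding N(1) by (simp_all add: power2_eq_square algebra_simps)
    show ?thesis unfolding Pair prod.case * c1 by simp
  qed
  have "inj ?g"
  proof (rule injI)
    fix z z' assume "?g z = ?g z'"
    then have "?h (?g z) = ?h (?g z')" by (rule arg_cong)
    then have "intmul N (fst z) = intmul N (fst z')" "intmul N (snd z) = intmul N (snd z')"
      unfolding hg by simp_all
    then have 0: "intmul N (fst z + - fst z') = 0" "intmul N (snd z + - snd z') = 0"
      unfolding intmul_add_right intmul_minus_right by simp_all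
    from intmul_eq_0_coprime[OF N(3) 0(1)] intmul_eq_0_coprime[OF N(3) 0(2)] show "z = z'" by (simp add: prod_eq_iff)
  qed
  then have bij: "bij ?g" by (simp add: bij_def finite_UNIV_inj_surj)
  have E: "?E (fst (?g (x, y))) (snd (?g (x, y))) \<simeq> - ?E x y" for x y
  proof -
    let ?x = "fst (?g (x, y))" and ?y = "snd (?g (x, y))"
    have b: "bform q ?x ?y \<simeq> of_int (1 * (t * n)) * (2 * q x) + of_int (1 * (1 + 2 * m * t)) * bform q x y +
       (of_int (- t * n' * (t * n)) * bform q y x + of_int (- t * n' * (1 + 2 * m * t)) * (2 * q y))"
      unfolding prod.case fst_conv snd_conv
      by (rule zcong_trans[OF bform_lincomb2[OF q]])
        (intro zcong_add zcong_mult zcong_refl bform_self q)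
    have "?E ?x ?y \<simeq>
       of_int n * (of_int (1\<^sup>2) * q x + of_int (1 * (- t * n')) * bform q x y + of_int ((- t * n')\<^sup>2) * q y) +
       of_int m * (of_int (1 * (t * n)) * (2 * q x) + of_int (1 * (1 + 2 * m * t)) * bform q x y +
       (of_int (- t * n' * (t * n)) * bform q y x + of_int (- t * n' * (1 + 2 * m * t)) * (2 * q y))) +
       of_int n' * (of_int ((t * n)\<^sup>2) * q x + of_int (t * n * (1 + 2 * m * t)) * bform q x y
         + of_int ((1 + 2 * m * t)\<^sup>2) * q y)"
      unfolding prod.case fst_conv snd_conv
      by (intro zcong_add[OF zcong_add] zcong_mult q_lincomb2 q b[unfolded prod.case fst_conv snd_conv])
    also have "\<dots> = of_int N * ?E x y"
      unfolding N(1) bform_commute[of q y x] by (simp add: power2_eq_square algebra_simps)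
    also have "\<dots> \<simeq> of_int (- 1) * ?E x y"
    proof (rule level_cong)
      have "of_int M * ?E x y = of_int n * (of_int M * q x) + of_int m * (of_int M * bform q x y)
          + of_int n' * (of_int M * q y)"
        by (simp add: algebra_simps)
      also have "\<dots> \<in> \<int>"
        by (intro Ints_add Ints_mult Ints_of_int M bform_level[OF M])
      finally show "of_int M * ?E x y \<in> \<int>" .
      show "M dvd N - - 1" using N(2) by simp
    qed
    finally show ?thesis by simp
  qed
  have "bsum q n m n' = (\<Sum>z\<in>UNIV. ef (?E (fst z) (snd z)))"
    by (simp add: bsum_def sum.cartesian_product case_prod_unfold)
  also have "\<dots> = (\<Sum>z\<in>UNIV. ef (?E (fst (?g z)) (snd (?g z))))"
    by (rule sum.reindex_bij_betw[symmetric, OF bij])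
  also have "\<dots> = (\<Sum>z\<in>UNIV. ef (- ?E (fst z) (snd z)))"
  proof (rule sum.cong[OF refl])
    fix z :: "'a \<times> 'a"
    show "ef (?E (fst (?g z)) (snd (?g z))) = ef (- ?E (fst z) (snd z))"
      using ef_cong[OF E[of "fst z" "snd z"]] by (simp only: prod.collapse)
  qed
  also have "\<dots> = cnj (\<Sum>z\<in>UNIV. ef (?E (fst z) (snd z)))"
    by (simp only: ef_minus cnj_sum)
  also have "(\<Sum>z\<in>UNIV. ef (?E (fst z) (snd z))) = bsum q n m n'"
    by (simp add: bsum_def sum.cartesian_product case_prod_unfold)
  finally show ?thesis .
qed

text \<open>Supplies the \<open>t\<close> for \<open>bsum_eq_cnj\<close>. If \<open>A\<close> is a
  half of \<open>n * n'\<close> modulo \<open>p ^ a\<close>, then \<open>N + 1\<close> is congruent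
  to \<open>2 * (A * t\<^sup>2 + m * t + 1)\<close>, so a root from \<open>hensel\<close> gives norm
  -1.\<close>

lemma bsum_real:
  fixes q :: "'a::{finite,ab_group_add} \<Rightarrow> rat" and p :: int
  assumes q: "quad_map q" and p: "prime p" and M: "\<And>x. of_int (p ^ a) * q x \<in> \<int>" and a: "a > 0"
    and n: "p dvd n" "p dvd n'" "\<not> p dvd m"
  shows "bsum q n m n' \<in> \<real>"
proof -
  have "int CARD('a) \<noteq> 0" by simp
  moreover have "\<not> is_unit p" using p by auto
  ultimately obtain D where D: "int CARD('a) = p ^ multiplicity p (int CARD('a)) * D" "\<not> p dvd D"
    by (rule multiplicity_decompose')
  \<comment> \<open>The half must stay divisible by \<open>p\<close> for \<open>hensel\<close>. For
    \<open>p = 2\<close> this holds because 4 divides \<open>n * n'\<close>; for odd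
    \<open>p\<close>, 2 is inverted modulo \<open>p ^ a\<close>.\<close>
  obtain A where A: "p dvd A" "p ^ a dvd 2 * A - n * n'"
  proof (cases "p = 2")
    case True
    obtain k l where "n = 2 * k" "n' = 2 * l" using n True by (auto elim!: dvdE)
    then show ?thesis using that[of "2 * k * l"] True by simp
  next
    case False
    then have "\<not> p dvd 2"
      using primes_dvd_imp_eq[OF p two_is_prime] by auto
    then have "coprime p 2" by (rule prime_imp_coprime[OF p])
    then have "coprime 2 (p ^ a)"
      by (metis coprime_commute coprime_power_right_iff)
    then obtain v where "[2 * v = 1] (mod p ^ a)"
      using cong_solve_coprime_int by blast
    then have "p ^ a dvd (2 * v - 1) * (n * n')"
      by (simp add: cong_iff_dvd_diff)
    then show ?thesis using that[of "v * (n * n')"] n(1) by (simp add: algebra_simps)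
  qed
  obtain s where s: "p ^ a dvd (A * D\<^sup>2) * s\<^sup>2 + (m * D) * s + 1"
    using hensel[OF p, of "A * D\<^sup>2" "m * D" a] A(1) n(3) D(2) p by (auto simp: prime_dvd_mult_iff)
  \<comment> \<open>\<open>q\<close> only sees \<open>t\<close> modulo \<open>p ^ a\<close>; the factor \<open>D\<close> makes \<open>N\<close> prime to the order of the group.\<close>
  define t where "t = D * s"
  define N where "N = 1 + 2 * m * t + n * n' * t\<^sup>2"
  have "N + 1 = 2 * ((A * D\<^sup>2) * s\<^sup>2 + (m * D) * s + 1) - (2 * A - n * n') * t\<^sup>2"
    by (simp add: N_def t_def power2_eq_square algebra_simps)
  then have N: "p ^ a dvd N + 1" by (simp only: dvd_diff dvd_mult dvd_mult2 s A(2))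
  have "coprime N p"
  proof -
    have "p dvd N + 1" using N a by (meson dvd_power dvd_trans)
    then have "\<not> p dvd N"
      using p by (metis dvd_add_right_iff not_prime_unit)
    then show ?thesis using prime_imp_coprime[OF p] by (simp add: coprime_commute)
  qed
  moreover have "coprime N D"
  proof -
    have "N = 1 + D * (2 * m * s + n * n' * t * s)"
      by (simp add: N_def t_def power2_eq_square algebra_simps)
    then show ?thesis
      by (metis coprime_1_left coprime_iff_gcd_eq_1 gcd_add_mult mult.commute add.commute gcd.commute)
  qed
  ultimately have "coprime N (p ^ multiplicity p (int CARD('a)) * D)" by simp
  then have "coprime N (int CARD('a))" using D(1) by simp
  from bsum_eq_cnj[OF q M N_def N this] show ?thesis
    by (simp add: Reals_cnj_iff)
qed

section \<open>Gauss sums of prime power level, then of arbitrary level\<close>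

lemma gsum_cong:
  assumes "\<And>i j. i \<in> I \<Longrightarrow> j \<in> I \<Longrightarrow> c i j = d i j"
  shows "gsum q I c = gsum q I d"
  unfolding gsum_def by (intro sum.cong refl arg_cong[of _ _ ef] qsum_cong assms)

lemma gsum_scale_coeff: "gsum q I (\<lambda>i j. k * c i j) = gsum (\<lambda>x. of_int k * q x) I c"
  by (simp add: gsum_def qsum_scale_coeff qsum_scale)

lemma tau_scale: "tau (\<lambda>x. of_int k * q x) n = tau q (k * n)"
  by (simp add: tau_def ac_simps)

lemma gsum_real_level_1:
  assumes "\<And>x. q x \<in> \<int>"
  shows "gsum q I c \<in> \<real>"
proof -
  have "bform q x y \<in> \<int>" for x y using assms by (simp add: bform_def)
  then have "qsum q I c f \<in> \<int>" for f
    unfolding qsum_def by (intro Ints_sum Ints_add Ints_mult Ints_of_int assms)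
  then have "ef (qsum q I c f) = 1" for f by (simp add: ef_eq_1_iff)
  then show ?thesis by (simp add: gsum_def)
qed

text \<open>The outer induction is on the exponent, the inner one on the size of the matrix. A pivot
  of size one or two shrinks the matrix; if there is none, \<open>p\<close> divides every entry and
  can be moved from \<open>c\<close> into \<open>q\<close>, which lowers the exponent. As the
  hypothesis on \<open>tau\<close> covers all multipliers, it passes to
  \<open>p * q\<close>.\<close>

lemma gsum_real_prime_power:
  fixes q :: "'a::{finite,ab_group_add} \<Rightarrow> rat" and p :: int
  assumes p: "prime p"
    and "quad_map q" "\<And>x. of_int (p ^ a) * q x \<in> \<int>" "\<And>n. tau q n \<in> \<real>"
    and "finite I" "\<And>i j. c i j = c j i"
  shows "gsum q I c \<in> \<real>"
  using assms(2-)
proof (induction a arbitrary: q I c)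
  case 0
  then show ?case by (intro gsum_real_level_1) auto
next
  case (Suc a)
  note q = \<open>quad_map q\<close> and M = Suc.prems(2) and tau = Suc.prems(3)
  have unit: "\<exists>u. p ^ Suc a dvd n * u - 1" if "\<not> p dvd n" for n
  proof -
    have "coprime n (p ^ Suc a)"
      using prime_imp_coprime[OF p that] by (simp add: coprime_commute)
    then show ?thesis
      using cong_solve_coprime_int by (metis cong_iff_dvd_diff)
  qed
  show ?case using Suc.prems(4,5)
  proof (induction "card I" arbitrary: I c rule: less_induct)
    case less
    note c = less.prems(2)
    consider (diag) i where "i \<in> I" "\<not> p dvd c i i"
      | (block) i j where "i \<in> I" "j \<in> I" "i \<noteq> j" "p dvd c i i" "p dvd c j j" "\<not> p dvd c i j"
      | (all) "\<And>i j. i \<in> I \<Longrightarrow> j \<in> I \<Longrightarrow> p dvd c i j"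
      by metis
    then show ?case
    proof cases
      case diag
      obtain J where J: "I = insert i J" "i \<notin> J" using diag by (meson mk_disjoint_insert)
      then have fin: "finite J" using less.prems by simp
      obtain u where u: "p ^ Suc a dvd c i i * u - 1" using unit diag by blast
      have "gsum q J (\<lambda>j k. c j k - c i i * ((u * c i j) * (u * c i k))) \<in> \<real>"
        using J fin c by (intro less.hyps) (auto simp: ac_simps)
      then show ?thesis
        unfolding J gsum_diag_pivot[where c = c, OF q M fin J(2) c u] using tau by simp
    next
      case block
      obtain J where J: "I = insert i (insert j J)" "i \<notin> J" "j \<notin> J"
        using block by (metis insert_iff mk_disjoint_insert)
      then have fin: "finite J" using less.prems by simp
      \<comment> \<open>Modulo \<open>p\<close> the determinant of the block is minus the square of
        its off-diagonal entry.\<close>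
      have "\<not> p dvd c i i * c j j - (c i j)\<^sup>2"
        using block p by (simp add: dvd_diff_right_iff prime_dvd_power_iff)
      then obtain d where "p ^ Suc a dvd d * (c i i * c j j - (c i j)\<^sup>2) - 1"
        using unit by (metis mult.commute)
      note piv = gsum_block_pivot[where c = c, OF q M fin J(2,3) \<open>i \<noteq> j\<close> c this refl refl]
      show ?thesis
        unfolding J piv
        using J fin c block(3)
        by (intro Reals_mult less.hyps bsum_real[OF q p M] block) (auto simp: ac_simps)
    next
      case all
      have "gsum q I c = gsum q I (\<lambda>i j. p * (c i j div p))"
        using all by (intro gsum_cong) auto
      also have "\<dots> = gsum (\<lambda>x. of_int p * q x) I (\<lambda>i j. c i j div p)"
        by (rule gsum_scale_coeff)
      also have "\<dots> \<in> \<real>"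
        using M c less.prems(1)
        by (intro Suc.IH quad_map_scale q) (auto simp: tau_scale tau ac_simps)
      finally show ?thesis .
    qed
  qed
qed

text \<open>The unimodular substitution \<open>f = h - e2 k\<close>, \<open>g = h + e1 k\<close> turns \<open>e1 Q(f) + e2 Q(g)\<close> into
  \<open>Q(h) + e1 e2 Q(k)\<close>.\<close>

lemma gsum_coprime_split:
  fixes q :: "'a::{finite,ab_group_add} \<Rightarrow> rat"
  assumes q: "quad_map q" and e: "e1 + e2 = 1" "\<And>x. of_int (e1 * e2) * q x \<in> \<int>"
  shows "gsum (\<lambda>x. of_int e1 * q x) I c * gsum (\<lambda>x. of_int e2 * q x) I c =
    of_nat (card (PiE I (\<lambda>_. UNIV :: 'a set))) * gsum q I c"
proof -
  let ?V = "PiE I (\<lambda>_. UNIV :: 'a set)"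
  let ?F = "\<lambda>h k. \<lambda>i\<in>I. intmul 1 (h i) + intmul (- e2) (k i)"
  let ?G = "\<lambda>h k. \<lambda>i\<in>I. intmul 1 (h i) + intmul e1 (k i)"
  have e1: "e1 = 1 - e2" using e(1) by simp
  have Z: "of_int (e1 * e2) * r \<simeq> 0" if "r = q x \<or> r = bform q x y" for r x y
    using e(2) bform_level[OF e(2)] that by (auto simp: zcong_0_iff)
  have qe: "of_int e1 * q (intmul 1 x + intmul (- e2) y) + of_int e2 * q (intmul 1 x + intmul e1 y) \<simeq> q x" for x y
  proof -
    have "of_int e1 * q (intmul 1 x + intmul (- e2) y) + of_int e2 * q (intmul 1 x + intmul e1 y) \<simeq>
      of_int e1 * (of_int (1\<^sup>2) * q x + of_int (1 * (- e2)) * bform q x y + of_int ((- e2)\<^sup>2) * q y) +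
      of_int e2 * (of_int (1\<^sup>2) * q x + of_int (1 * e1) * bform q x y + of_int (e1\<^sup>2) * q y)"
      by (intro zcong_add zcong_mult q_lincomb2 q)
    also have "\<dots> = q x + of_int (e1 * e2) * q y"
      unfolding e1 by (simp add: power2_eq_square algebra_simps)
    also have "\<dots> \<simeq> q x + 0" by (intro zcong_add zcong_refl Z) auto
    finally show ?thesis by simp
  qed
  have be: "of_int e1 * bform q (intmul 1 x + intmul (- e2) y) (intmul 1 x' + intmul (- e2) y') +
      of_int e2 * bform q (intmul 1 x + intmul e1 y) (intmul 1 x' + intmul e1 y') \<simeq> bform q x x'" for x y x' y'
  proof -
    have "of_int e1 * bform q (intmul 1 x + intmul (- e2) y) (intmul 1 x' + intmul (- e2) y') +
      of_int e2 * bform q (intmul 1 x + intmul e1 y) (intmul 1 x' + intmul e1 y') \<simeq>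
      of_int e1 * (of_int (1 * 1) * bform q x x' + of_int (1 * (- e2)) * bform q x y' +
       (of_int ((- e2) * 1) * bform q y x' + of_int ((- e2) * (- e2)) * bform q y y')) +
      of_int e2 * (of_int (1 * 1) * bform q x x' + of_int (1 * e1) * bform q x y' +
       (of_int (e1 * 1) * bform q y x' + of_int (e1 * e1) * bform q y y'))"
      by (intro zcong_add zcong_mult bform_lincomb2 q)
    also have "\<dots> = bform q x x' + of_int (e1 * e2) * bform q y y'"
      unfolding e1 by (simp add: algebra_simps)
    also have "\<dots> \<simeq> bform q x x' + 0" by (intro zcong_add zcong_refl Z) auto
    finally show ?thesis by simp
  qed
  have Q: "of_int e1 * qsum q I c (?F h k) + of_int e2 * qsum q I c (?G h k) \<simeq> qsum q I c h" for h k
  proof -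
    have eq: "of_int e1 * qsum q I c (?F h k) + of_int e2 * qsum q I c (?G h k) =
      (\<Sum>i\<in>I. of_int (c i i) * (of_int e1 * q (?F h k i) + of_int e2 * q (?G h k i)) +
        (\<Sum>j\<in>{j\<in>I. j < i}. of_int (c i j) *
          (of_int e1 * bform q (?F h k i) (?F h k j) + of_int e2 * bform q (?G h k i) (?G h k j))))"
      unfolding qsum_def sum_distrib_left[of _ _ I] sum.distrib[of _ _ I, symmetric]
      by (intro sum.cong refl) (simp add: sum_distrib_left sum.distrib distrib_left mult.left_commute)
    show ?thesis
      unfolding eq unfolding qsum_def
    proof (intro zcong_sum zcong_add zcong_mult)
      fix i assume "i \<in> I"
      then show "of_int e1 * q (?F h k i) + of_int e2 * q (?G h k i) \<simeq> q (h i)"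
        using qe[of "h i" "k i"] by (simp only: restrict_apply if_True)
      fix j assume "j \<in> {j \<in> I. j < i}"
      with \<open>i \<in> I\<close> show "of_int e1 * bform q (?F h k i) (?F h k j) + of_int e2 * bform q (?G h k i) (?G h k j)
          \<simeq> bform q (h i) (h j)"
        using be[of "h i" "k i" "h j" "k j"] by (simp only: restrict_apply if_True mem_Collect_eq)
    qed
  qed
  have inv: "intmul e1 (x + intmul (- e2) y) + intmul e2 (x + intmul e1 y) = x" for x y :: 'a
  proof -
    have "intmul e1 (x + intmul (- e2) y) = intmul e1 x - intmul (e1 * e2) y"
      by (simp add: intmul_diff_right intmul_mult[symmetric] intmul_minus_left)
    moreover have "intmul e2 (x + intmul e1 y) = intmul e2 x + intmul (e1 * e2) y"
      by (simp add: intmul_add_right intmul_mult[symmetric] mult.commute)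
    ultimately have "intmul e1 (x + intmul (- e2) y) + intmul e2 (x + intmul e1 y) = intmul (e1 + e2) x"
      by (simp add: intmul_add_left)
    then show ?thesis using e(1) by simp
  qed
  have inv1: "intmul e1 x + intmul e2 y + intmul (- e2) (y - x) = x" for x y :: 'a
  proof -
    have "intmul e1 x + intmul e2 y + intmul (- e2) (y - x) = intmul (e1 + e2) x"
      by (simp add: intmul_diff_right intmul_add_left intmul_minus_left)
    then show ?thesis using e(1) by simp
  qed
  have inv2: "intmul e1 x + intmul e2 y + intmul e1 (y - x) = y" for x y :: 'a
  proof -
    have "intmul e1 x + intmul e2 y + intmul e1 (y - x) = intmul (e1 + e2) y"
      by (simp add: intmul_diff_right intmul_add_left)
    then show ?thesis using e(1) by simp
  qed
  have inv3: "intmul e1 y - intmul (- e2) y = y" for y :: 'a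
  proof -
    have "intmul e1 y - intmul (- e2) y = intmul (e1 + e2) y"
      by (simp add: intmul_add_left intmul_minus_left)
    then show ?thesis using e(1) by simp
  qed
  have "gsum (\<lambda>x. of_int e1 * q x) I c * gsum (\<lambda>x. of_int e2 * q x) I c =
     (\<Sum>(f, g)\<in>?V \<times> ?V. ef (of_int e1 * qsum q I c f + of_int e2 * qsum q I c g))"
    by (simp add: gsum_def qsum_scale sum_product sum.cartesian_product ef_add)
  \<comment> \<open>The substitution has determinant \<open>e1 + e2 = 1\<close>; its inverse is
    \<open>h = e1 f + e2 g\<close>, \<open>k = g - f\<close>.\<close>
  also have "\<dots> = (\<Sum>(h, k)\<in>?V \<times> ?V. ef (of_int e1 * qsum q I c (?F h k) + of_int e2 * qsum q I c (?G h k)))"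
    by (rule sum.reindex_bij_witness[of _ "\<lambda>(h, k). (?F h k, ?G h k)"
        "\<lambda>(f, g). (\<lambda>i\<in>I. intmul e1 (f i) + intmul e2 (g i), \<lambda>i\<in>I. g i - f i)"])
      (auto simp: fun_eq_iff PiE_def extensional_def inv inv1 inv2 inv3
        intro!: arg_cong2[of _ _ _ _ "\<lambda>u v. ef (of_int e1 * u + of_int e2 * v)"] qsum_cong)
  \<comment> \<open>\<open>e1 * e2\<close> annihilates \<open>q\<close>, so \<open>k\<close> drops
    out of the exponent and its sum contributes only the cardinality.\<close>
  also have "\<dots> = (\<Sum>(h, k)\<in>?V \<times> ?V. ef (qsum q I c h))"
    using ef_cong[OF Q] by (simp only:)
  also have "\<dots> = of_nat (card ?V) * gsum q I c"
    by (simp add: gsum_def sum.cartesian_product[symmetric] sum_distrib_left)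
  finally show ?thesis .
qed

text \<open>Splits off one prime power at a time. By \<open>gsum_coprime_split\<close>, a positive
  integer times the Gauss sum is a product of two real ones.\<close>

lemma gsum_real_level:
  fixes q :: "'a::{finite,ab_group_add} \<Rightarrow> rat"
  assumes "M > 0"
    and "quad_map q" "\<And>x. of_int (int M) * q x \<in> \<int>" "\<And>n. tau q n \<in> \<real>"
    and I: "finite I" and c: "\<And>i j. c i j = c j i"
  shows "gsum q I c \<in> \<real>"
  using assms(1-4)
proof (induction M arbitrary: q rule: less_induct)
  case (less M)
  note q = \<open>quad_map q\<close> and M = less.prems(3) and tau = less.prems(4)
  show ?case
  proof (cases "M = 1")
    case True
    then show ?thesis using M by (intro gsum_real_level_1) auto
  next
    case False
    then obtain p where p: "prime p" "p dvd M" by (meson prime_factor_nat)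
    obtain M' where M': "M = p ^ multiplicity p M * M'" "\<not> p dvd M'"
      using multiplicity_decompose'[of M p] less.prems(1) p by (metis not_prime_unit not_gr_zero mult.commute)
    define a where "a = multiplicity p M"
    have Ma: "M = p ^ a * M'" using M'(1) by (simp add: a_def)
    have "a \<noteq> 0"
      using Ma M'(2) p(2) by (cases a) auto
    moreover have "M' > 0" using Ma less.prems(1) by (metis mult_0_right not_gr_zero)
    ultimately have "M' < M" using one_less_power[OF prime_gt_1_nat[OF p(1)], of a] unfolding Ma by simp
    have "coprime (int p ^ a) (int M')"
      using prime_imp_coprime[OF p(1) M'(2)] by simp
    then obtain u v where uv: "u * int p ^ a + v * int M' = 1"
      by (metis bezout_int coprime_imp_gcd_eq_1)
    \<comment> \<open>The Chinese remainder idempotents modulo \<open>M\<close>: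
      \<open>e1 * q\<close> has level \<open>p ^ a\<close>, \<open>e2 * q\<close> has level
      \<open>M'\<close>, and \<open>M\<close> divides \<open>e1 * e2\<close>.\<close>
    define e1 e2 where "e1 = v * int M'" and "e2 = u * int p ^ a"
    have e: "e1 + e2 = 1" using uv by (simp add: e1_def e2_def)
    have lev: "of_int (k * int M) * q x \<in> \<int>" for k x
      using Ints_mult[OF Ints_of_int[of k] M[of x]] by (simp add: mult.assoc)
    have "gsum (\<lambda>x. of_int e1 * q x) I c \<in> \<real>"
    proof (rule gsum_real_prime_power[OF _ quad_map_scale[OF q] _ _ I c])
      show "prime (int p)" using p(1) by simp
      show "of_int (int p ^ a) * (of_int e1 * q x) \<in> \<int>" for x
        using lev[of v x] by (simp add: e1_def Ma ac_simps)
    qed (simp add: tau_scale tau)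
    moreover have "gsum (\<lambda>x. of_int e2 * q x) I c \<in> \<real>"
    proof (rule less.IH[OF \<open>M' < M\<close> \<open>M' > 0\<close> quad_map_scale[OF q]])
      show "of_int (int M') * (of_int e2 * q x) \<in> \<int>" for x
        using lev[of u x] by (simp add: e2_def Ma ac_simps)
    qed (simp add: tau_scale tau)
    moreover have "of_int (e1 * e2) * q x \<in> \<int>" for x
      using lev[of "u * v" x] by (simp add: e1_def e2_def Ma ac_simps)
    ultimately have "of_nat (card (PiE I (\<lambda>_. UNIV :: 'a set))) * gsum q I c \<in> \<real>"
      using gsum_coprime_split[OF q e, of I c] by (metis Reals_mult)
    moreover have "card (PiE I (\<lambda>_. UNIV :: 'a set)) \<noteq> 0"
      using I by (simp add: card_PiE)
    ultimately show ?thesis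
      by (metis Reals_divide Reals_of_nat nonzero_mult_div_cancel_left of_nat_eq_0_iff)
  qed
qed

section \<open>Counting isometries and anti-isometries\<close>

text \<open>Orthogonality of characters of Z/N, through a geometric sum.\<close>

lemma sum_ef_multiples:
  assumes "of_nat N * r \<in> \<int>"
  shows "(\<Sum>n<N. ef (of_int (int n) * r)) = (if r \<in> \<int> then of_nat N else 0)"
proof -
  have pow: "ef (of_int (int n) * r) = ef r ^ n" for n
    by (induction n) (simp_all add: distrib_right ef_add)
  show ?thesis
  proof (cases "r \<in> \<int>")
    case True
    then have "ef r = 1" by (simp add: ef_eq_1_iff)
    then show ?thesis using True by (simp only: pow) simp
  next
    case False
    then have "ef r \<noteq> 1" by (simp add: ef_eq_1_iff)
    moreover have "ef r ^ N = 1"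
      using assms pow[of N] ef_eq_1_iff[of "of_nat N * r"] by simp
    ultimately show ?thesis using False by (simp only: pow) (simp add: geometric_sum)
  qed
qed

text \<open>Each congruence is detected by a character sum over Z/N. Expanding the product over
  \<open>T\<close> turns the multipliers \<open>c\<close> into Fourier variables, and
  \<open>w\<close> enters only through the weights.\<close>

lemma card_solutions_fourier:
  fixes v :: "'g \<Rightarrow> 't \<Rightarrow> rat"
  assumes V: "finite V" and T: "finite T"
    and v: "\<And>g t. of_nat N * v g t \<in> \<int>" and w: "\<And>t. of_nat N * w t \<in> \<int>"
  shows "of_nat (N ^ card T * card {g \<in> V. \<forall>t\<in>T. v g t \<simeq> w t}) =
    (\<Sum>c\<in>PiE T (\<lambda>_. {..<N}). ef (- (\<Sum>t\<in>T. of_int (int (c t)) * w t)) *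
       (\<Sum>g\<in>V. ef (\<Sum>t\<in>T. of_int (int (c t)) * v g t)))"
proof -
  have ind: "(\<Prod>t\<in>T. if v g t - w t \<in> \<int> then of_nat N else 0) =
      (if \<forall>t\<in>T. v g t \<simeq> w t then of_nat (N ^ card T) else (0::complex))" for g
    using T by (auto simp: zcong_def intro!: prod_zero)
  have "of_nat (N ^ card T * card {g \<in> V. \<forall>t\<in>T. v g t \<simeq> w t}) =
     (\<Sum>g\<in>V. if \<forall>t\<in>T. v g t \<simeq> w t then of_nat (N ^ card T) else (0::complex))"
    using V by (simp add: sum.inter_filter[symmetric] mult.commute)
  also have "\<dots> = (\<Sum>g\<in>V. \<Prod>t\<in>T. \<Sum>n<N. ef (of_int (int n) * (v g t - w t)))"
    unfolding ind[symmetric]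
  proof (intro sum.cong prod.cong refl sum_ef_multiples[symmetric])
    show "of_nat N * (v g t - w t) \<in> \<int>" for g t
      using v w by (simp add: right_diff_distrib)
  qed
  also have "\<dots> = (\<Sum>g\<in>V. \<Sum>c\<in>PiE T (\<lambda>_. {..<N}). \<Prod>t\<in>T. ef (of_int (int (c t)) * (v g t - w t)))"
    using T by (subst prod_sum_PiE) auto
  also have "\<dots> = (\<Sum>c\<in>PiE T (\<lambda>_. {..<N}). \<Sum>g\<in>V. \<Prod>t\<in>T. ef (of_int (int (c t)) * (v g t - w t)))"
    by (rule sum.swap)
  also have "\<dots> = (\<Sum>c\<in>PiE T (\<lambda>_. {..<N}). ef (- (\<Sum>t\<in>T. of_int (int (c t)) * w t)) *
       (\<Sum>g\<in>V. ef (\<Sum>t\<in>T. of_int (int (c t)) * v g t)))"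
    unfolding sum_distrib_left ef_add[symmetric] ef_sum[symmetric]
    by (simp add: right_diff_distrib sum_subtractf)
  finally show ?thesis .
qed

text \<open>Negating \<open>w\<close> conjugates the weights and leaves the real sums over
  \<open>V\<close> fixed, so it conjugates the count, which is a natural number.\<close>

lemma card_solutions_uminus:
  fixes v :: "'g \<Rightarrow> 't \<Rightarrow> rat"
  assumes V: "finite V" and T: "finite T" and N: "N > 0"
    and v: "\<And>g t. of_nat N * v g t \<in> \<int>" and w: "\<And>t. of_nat N * w t \<in> \<int>"
    and real: "\<And>c. (\<Sum>g\<in>V. ef (\<Sum>t\<in>T. of_int (c t) * v g t)) \<in> \<real>"
  shows "card {g \<in> V. \<forall>t\<in>T. v g t \<simeq> - w t} = card {g \<in> V. \<forall>t\<in>T. v g t \<simeq> w t}"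
proof -
  let ?A = "\<lambda>w. of_nat (N ^ card T * card {g \<in> V. \<forall>t\<in>T. v g t \<simeq> w t}) :: complex"
  let ?C = "PiE T (\<lambda>_. {..<N})"
  let ?G = "\<lambda>c :: 't \<Rightarrow> nat. \<Sum>g\<in>V. ef (\<Sum>t\<in>T. of_int (int (c t)) * v g t)"
  have w': "of_nat N * - w t \<in> \<int>" for t using w[of t] by simp
  have G: "cnj (?G c) = ?G c" for c
    using real[of "\<lambda>t. int (c t)"] unfolding Reals_cnj_iff .
  have "?A (\<lambda>t. - w t) = (\<Sum>c\<in>?C. ef (- (\<Sum>t\<in>T. of_int (int (c t)) * - w t)) * ?G c)"
    by (rule card_solutions_fourier[OF V T v w'])
  also have "\<dots> = (\<Sum>c\<in>?C. cnj (ef (- (\<Sum>t\<in>T. of_int (int (c t)) * w t))) * cnj (?G c))"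
    unfolding G ef_minus[symmetric] by (simp add: sum_negf)
  also have "\<dots> = cnj (\<Sum>c\<in>?C. ef (- (\<Sum>t\<in>T. of_int (int (c t)) * w t)) * ?G c)"
    by (simp only: cnj_sum complex_cnj_mult)
  also have "\<dots> = cnj (?A w)"
    by (simp only: card_solutions_fourier[OF V T v w])
  also have "\<dots> = ?A w" by simp
  finally show ?thesis using N by (simp only: of_nat_eq_iff) simp
qed

text \<open>The diagonal stores \<open>q\<close> itself, because \<open>bform q x x\<close>
  determines only \<open>2 * q x\<close>.\<close>

definition gram :: "('a::ab_group_add \<Rightarrow> rat) \<Rightarrow> (nat \<Rightarrow> 'a) \<Rightarrow> nat \<times> nat \<Rightarrow> rat" where
  "gram q g = (\<lambda>(i, j). if i = j then q (g i) else bform q (g i) (g j))"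

text \<open>Multipliers are indexed by pairs with \<open>j \<le> i\<close>; \<open>max\<close> and
  \<open>min\<close> extend them to the symmetric matrix that \<open>gsum_real_level\<close>
  expects.\<close>

lemma sum_gram:
  assumes "finite I"
  shows "(\<Sum>t\<in>(SIGMA i:I. {j\<in>I. j \<le> i}). of_int (c t) * gram q g t) =
    qsum q I (\<lambda>i j. c (max i j, min i j)) g"
proof -
  have "(\<Sum>j\<in>{j\<in>I. j \<le> i}. of_int (c (i, j)) * gram q g (i, j)) =
    of_int (c (i, i)) * q (g i) + (\<Sum>j\<in>{j\<in>I. j < i}. of_int (c (max i j, min i j)) * bform q (g i) (g j))"
    if "i \<in> I" for i
  proof -
    have "{j\<in>I. j \<le> i} = insert i {j\<in>I. j < i}" using that by auto
    then have "(\<Sum>j\<in>{j\<in>I. j \<le> i}. of_int (c (i, j)) * gram q g (i, j)) =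
      of_int (c (i, i)) * gram q g (i, i) + (\<Sum>j\<in>{j\<in>I. j < i}. of_int (c (i, j)) * gram q g (i, j))"
      using assms by simp
    also have "(\<Sum>j\<in>{j\<in>I. j < i}. of_int (c (i, j)) * gram q g (i, j)) =
      (\<Sum>j\<in>{j\<in>I. j < i}. of_int (c (max i j, min i j)) * bform q (g i) (g j))"
      by (intro sum.cong) (auto simp: gram_def max_def min_def)
    finally show ?thesis by (simp add: gram_def)
  qed
  moreover have "(\<Sum>t\<in>(SIGMA i:I. {j\<in>I. j \<le> i}). of_int (c t) * gram q g t) =
      (\<Sum>i\<in>I. \<Sum>j\<in>{j\<in>I. j \<le> i}. of_int (c (i, j)) * gram q g (i, j))"
    using assms by (simp add: sum.Sigma case_prod_unfold)
  ultimately show ?thesis by (simp add: qsum_def)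
qed

text \<open>Since \<open>CARD('a)\<close> annihilates the group, its square annihilates the values
  of \<open>q\<close>. This number serves both as the level and as the modulus of the Fourier
  inversion.\<close>

lemma quad_map_level:
  fixes q :: "'a::{finite,ab_group_add} \<Rightarrow> rat"
  assumes "quad_map q"
  shows "of_int (int (CARD('a)\<^sup>2)) * q x \<in> \<int>"
proof -
  have "of_int ((int CARD('a))\<^sup>2) * q x \<simeq> q (intmul (int CARD('a)) x)"
    by (rule zcong_sym[OF q_intmul[OF assms]])
  also have "\<dots> \<simeq> 0" unfolding intmul_card by (rule q_0[OF assms])
  finally show ?thesis by (simp add: zcong_0_iff)
qed

text \<open>Nondegeneracy gives injectivity, and finiteness then surjectivity. The additivity defect
  of \<open>\<gamma>\<close> is orthogonal to the image of \<open>\<gamma>\<close>, hence to the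
  whole group, hence zero.\<close>

lemma anti_isometry_bij_additive:
  fixes q :: "'a::{finite,ab_group_add} \<Rightarrow> rat" and \<gamma> :: "'a \<Rightarrow> 'a"
  assumes q: "quad_map q" and nondeg: "\<And>x. (\<And>y. bform q x y \<in> \<int>) \<Longrightarrow> x = 0"
    and g: "\<And>x y. bform q (\<gamma> x) (\<gamma> y) \<simeq> - bform q x y"
  shows "bij \<gamma>" "\<gamma> (x + y) = \<gamma> x + \<gamma> y"
proof -
  have diff: "bform q (x - y) z \<simeq> bform q x z - bform q y z" for x y z
    using zcong_trans[OF bform_add_left[OF q, of x "- y" z] zcong_add[OF zcong_refl bform_minus_left[OF q]]]
    by simp
  have "inj \<gamma>"
  proof (rule injI)
    fix x y assume eq: "\<gamma> x = \<gamma> y"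
    have "bform q (x - y) z \<in> \<int>" for z
    proof -
      have "bform q x z \<simeq> - bform q (\<gamma> x) (\<gamma> z)" "bform q y z \<simeq> - bform q (\<gamma> y) (\<gamma> z)"
        using zcong_minus[OF zcong_sym[OF g]] by simp_all
      from zcong_trans[OF diff zcong_diff[OF this]] show ?thesis
        by (simp add: eq zcong_0_iff)
    qed
    then show "x = y" using nondeg[of "x - y"] by simp
  qed
  then show bij: "bij \<gamma>" by (simp add: bij_def finite_UNIV_inj_surj)
  have "bform q (\<gamma> (x + y) - (\<gamma> x + \<gamma> y)) z \<in> \<int>" for z
  proof -
    obtain u where u: "z = \<gamma> u" using bij by (metis bij_pointE)
    have "bform q (\<gamma> (x + y) - (\<gamma> x + \<gamma> y)) z \<simeq>
        bform q (\<gamma> (x + y)) z - (bform q (\<gamma> x) z + bform q (\<gamma> y) z)"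
      by (rule zcong_trans[OF diff]) (intro zcong_diff zcong_refl bform_add_left q)
    also have "\<dots> \<simeq> - (bform q x u + bform q y u) - (- bform q x u + - bform q y u)"
      unfolding u
      by (intro zcong_diff zcong_add g zcong_trans[OF g[of "x + y" u]] zcong_minus bform_add_left q)
    finally show ?thesis by (simp add: zcong_0_iff)
  qed
  then show "\<gamma> (x + y) = \<gamma> x + \<gamma> y" using nondeg[of "\<gamma> (x + y) - (\<gamma> x + \<gamma> y)"] by simp
qed

text \<open>A map on the group is a tuple indexed by an enumeration \<open>en\<close>. Isometries
  are the tuples with the Gram data of \<open>en\<close>, anti-isometries those with the negated
  data; the two counts agree.\<close>

lemma anti_isometry_exists:
  fixes q :: "'a::{finite,ab_group_add} \<Rightarrow> rat"
  assumes q: "quad_map q" and tau: "\<And>n. tau q n \<in> \<real>"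
  shows "\<exists>\<gamma>::'a \<Rightarrow> 'a. (\<forall>x. q (\<gamma> x) \<simeq> - q x) \<and> (\<forall>x y. bform q (\<gamma> x) (\<gamma> y) \<simeq> - bform q x y)"
proof -
  obtain en :: "nat \<Rightarrow> 'a" where en: "bij_betw en {0..<CARD('a)} UNIV"
    using ex_bij_betw_nat_finite[of "UNIV :: 'a set"] by auto
  define I where "I = {0..<CARD('a)}"
  define V where "V = PiE I (\<lambda>_. UNIV :: 'a set)"
  define T where "T = (SIGMA i:I. {j\<in>I. j \<le> i})"
  define N where "N = CARD('a)\<^sup>2"
  have fin: "finite I" "finite V" "finite T"
    by (auto simp: I_def V_def T_def intro!: finite_PiE)
  have N: "N > 0" by (simp add: N_def)
  have lev: "of_nat N * q x \<in> \<int>" for x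
    using quad_map_level[OF q, of x] by (simp add: N_def)
  then have gram_lev: "of_nat N * gram q g t \<in> \<int>" for g t
    by (cases t) (auto simp: gram_def bform_def right_diff_distrib)
  have real: "(\<Sum>g\<in>V. ef (\<Sum>t\<in>T. of_int (c t) * gram q g t)) \<in> \<real>" for c
  proof -
    have "gsum q I (\<lambda>i j. c (max i j, min i j)) \<in> \<real>"
      using lev by (intro gsum_real_level[OF N q _ tau fin(1)]) (auto simp: max.commute min.commute)
    then show ?thesis by (simp add: gsum_def V_def T_def sum_gram[OF fin(1)])
  qed
  \<comment> \<open>The identity map is an isometry; it is restricted since \<open>V\<close>
    consists of extensional functions.\<close>
  have "restrict en I \<in> {g \<in> V. \<forall>t\<in>T. gram q g t \<simeq> gram q en t}"
    by (auto simp: V_def T_def gram_def)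
  then have "card {g \<in> V. \<forall>t\<in>T. gram q g t \<simeq> gram q en t} \<noteq> 0"
    using fin(2) by (metis (no_types, lifting) card_eq_0_iff empty_iff finite_Collect_conjI finite_subset mem_Collect_eq subsetI)
  then have "card {g \<in> V. \<forall>t\<in>T. gram q g t \<simeq> - gram q en t} \<noteq> 0"
    using card_solutions_uminus[of V T N "gram q" "gram q en"] fin N gram_lev real by simp
  then obtain g where g: "\<And>t. t \<in> T \<Longrightarrow> gram q g t \<simeq> - gram q en t"
    by (metis (no_types, lifting) card.empty empty_Collect_eq)
  \<comment> \<open>Back from tuples to maps on the group.\<close>
  define \<gamma> where "\<gamma> x = g (the_inv_into I en x)" for x
  have idx: "\<exists>i\<in>I. en i = x \<and> \<gamma> x = g i" for x
    using en unfolding \<gamma>_def I_def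
    by (metis UNIV_I bij_betw_def f_the_inv_into_f the_inv_into_into order_refl)
  have 1: "q (\<gamma> x) \<simeq> - q x" for x
  proof -
    obtain i where "i \<in> I" "en i = x" "\<gamma> x = g i" using idx by blast
    then show ?thesis using g[of "(i, i)"] by (simp add: T_def gram_def)
  qed
  have 2: "bform q (\<gamma> x) (\<gamma> y) \<simeq> - bform q x y" for x y
  proof -
    obtain i j where i: "i \<in> I" "en i = x" "\<gamma> x = g i" and j: "j \<in> I" "en j = y" "\<gamma> y = g j"
      using idx by meson
    consider "i = j" | "j < i" | "i < j" by linarith
    then show ?thesis
    proof cases
      case 1
      then have "\<gamma> x = \<gamma> y" "x = y" using i j by auto
      \<comment> \<open>The diagonal Gram data concern \<open>q\<close> only, so
        \<open>bform\<close> on equal arguments is recovered as twice \<open>q\<close>.\<close>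
      have "bform q (\<gamma> y) (\<gamma> y) \<simeq> of_int 2 * q (\<gamma> y)" using bform_self[OF q] by simp
      also have "\<dots> \<simeq> of_int 2 * - q y" by (intro zcong_mult \<open>\<And>x. q (\<gamma> x) \<simeq> - q x\<close>)
      also have "\<dots> = - (2 * q y)" by simp
      also have "\<dots> \<simeq> - bform q y y" by (intro zcong_minus zcong_sym[OF bform_self[OF q]])
      finally show ?thesis using \<open>x = y\<close> by simp
    next
      case 2
      then show ?thesis using g[of "(i, j)"] i j by (simp add: T_def gram_def)
    next
      case 3
      then show ?thesis using g[of "(j, i)"] i j by (simp add: T_def gram_def bform_commute)
    qed
  qed
  show ?thesis using 1 2 by blast
qed

lemma gauss_sum_eq_tau: "gauss_sum n q = tau q (int n)"
  by (simp add: gauss_sum_def tau_def ef_def cis_conv_exp of_rat_mult ac_simps)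

lemma tau_uminus: "tau q (- n) = cnj (tau q n)"
  by (simp add: tau_def ef_minus)

text \<open>For \<open>n = 0\<close> the sum is the group order, and a negative \<open>n\<close>
  gives the conjugate of the sum for \<open>- n\<close>.\<close>

lemma tau_real:
  assumes "\<forall>n\<ge>1. gauss_sum n q \<in> \<real>"
  shows "tau q n \<in> \<real>"
proof -
  have pos: "tau q (int m) \<in> \<real>" for m
    using assms by (cases "m = 0") (auto simp: gauss_sum_eq_tau tau_def)
  show ?thesis
    using pos[of "nat n"] pos[of "nat (- n)"] tau_uminus[of q "- n"]
    by (cases "n \<ge> 0") (auto simp: Reals_cnj_iff)
qed

theorem theorem4:
  fixes q :: "'a::{finite,ab_group_add} \<Rightarrow> rat"
  assumes "finite_quadratic_form q"
  shows "(\<exists>\<gamma>::'a \<Rightarrow> 'a. bij \<gamma> \<and> (\<forall>x y. \<gamma> (x + y) = \<gamma> x + \<gamma> y) \<and>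
            (\<forall>x. q (\<gamma> x) + q x \<in> \<int>))
         \<longleftrightarrow> (\<forall>n\<ge>1. gauss_sum n q \<in> \<real>)"
proof
  assume "\<exists>\<gamma>::'a \<Rightarrow> 'a. bij \<gamma> \<and> (\<forall>x y. \<gamma> (x + y) = \<gamma> x + \<gamma> y) \<and> (\<forall>x. q (\<gamma> x) + q x \<in> \<int>)"
  then obtain \<gamma> :: "'a \<Rightarrow> 'a" where \<gamma>: "bij \<gamma>" "\<And>x. q (\<gamma> x) \<simeq> - q x"
    by (auto simp: zcong_def)
  have "tau q n = cnj (tau q n)" for n
  proof -
    have "tau q n = (\<Sum>x\<in>UNIV. ef (of_int n * q (\<gamma> x)))"
      unfolding tau_def by (rule sum.reindex_bij_betw[OF \<gamma>(1), symmetric])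
    also have "\<dots> = (\<Sum>x\<in>UNIV. ef (of_int n * - q x))"
      by (intro sum.cong refl ef_cong zcong_mult \<gamma>(2))
    finally show ?thesis by (simp add: tau_def ef_minus)
  qed
  then show "\<forall>n\<ge>1. gauss_sum n q \<in> \<real>"
    by (simp add: gauss_sum_eq_tau Reals_cnj_iff)
next
  assume "\<forall>n\<ge>1. gauss_sum n q \<in> \<real>"
  then have tau: "tau q n \<in> \<real>" for n by (rule tau_real)
  have q: "quad_map q" and nondeg: "\<And>x. (\<And>y. bform q x y \<in> \<int>) \<Longrightarrow> x = 0"
    using assms by (auto simp: finite_quadratic_form_def quad_map_def zcong_def diff_diff_eq)
  obtain \<gamma> :: "'a \<Rightarrow> 'a" where \<gamma>: "\<And>x. q (\<gamma> x) \<simeq> - q x" "\<And>x y. bform q (\<gamma> x) (\<gamma> y) \<simeq> - bform q x y"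
    using anti_isometry_exists[OF q tau] by blast
  have "q (\<gamma> x) + q x \<in> \<int>" for x using \<gamma>(1)[of x] by (simp add: zcong_def)
  then show "\<exists>\<gamma>::'a \<Rightarrow> 'a. bij \<gamma> \<and> (\<forall>x y. \<gamma> (x + y) = \<gamma> x + \<gamma> y) \<and> (\<forall>x. q (\<gamma> x) + q x \<in> \<int>)"
    using anti_isometry_bij_additive[OF q nondeg \<gamma>(2)] by blast
qed

end
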